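(* Let $(X,Y),(X_1,Y_1),\dots,(X_n,Y_n)$ be i.i.d. random pairs in $\mathbb R^d\times\mathbb R$ with $\mathbb E\|X\|^2<+\infty$, $\mathbb E[Y^2]<+\infty$ and $\|X\|\le R$ almost surely for some constant $R>0$. Then, for any $B>0$, the Ridge-penalized Sample Minmax Predictor $\widetilde f_{\lambda,n}$ for the Gaussian linear family $\mathcal F=\{f_\theta(\cdot\mid x)=\mathcal N(\langle\theta,x\rangle,1):\theta\in\mathbb R^d\}$, with $\lambda=d/(B^2(n+1))$, satisfies $$\mathbb E\big[\mathcal R(\widetilde f_{\lambda,n})\big]-\inf_{\theta\in\mathbb R^d:\ \|\theta\|\le B}\mathcal R(f_\theta)\le\frac{5\,d\,\log\big(2+BR/\sqrt d\big)}{n+1}.$$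
   Context: Densities are with respect to $\mu(dy)=(2\pi)^{-1/2}dy$ on $\mathbb R$, so $-\log f_\theta(y\mid x)=\frac12(y-\langle\theta,x\rangle)^2$. The risk of a conditional density $g$ is $\mathcal R(g)=\mathbb E[-\log g(Y\mid X)]$; $\mathbb E[\mathcal R(\widetilde f_{\lambda,n})]$ denotes expectation over the sample. For $\lambda>0$ the Ridge-penalized Sample Minmax Predictor is $$\widetilde f_{\lambda,n}(y\mid x)=\frac{f_{\widehat\theta_{\lambda,n}^{(x,y)}}(y\mid x)\,e^{-\lambda\|\widehat\theta_{\lambda,n}^{(x,y)}\|^2/2}}{\int_{\mathbb R}f_{\widehat\theta_{\lambda,n}^{(x,y')}}(y'\mid x)\,e^{-\lambda\|\widehat\theta_{\lambda,n}^{(x,y')}\|^2/2}\mu(dy')},$$ where $\widehat\theta_{\lambda,n}^{(x,y)}=\operatorname{arg\,min}_{\theta\in\mathbb R^d}\big\{\sum_{i=1}^n\frac12(Y_i-\langle\theta,X_i\rangle)^2+\frac12(y-\langle\theta,x\rangle)^2+(n+1)\frac\lambda2\|\theta\|^2\big\}$. *)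

theory Defs
  imports "HOL-Probability.Probability"
begin

definition ref_measure :: "real measure" where
  "ref_measure = density lborel (\<lambda>_. ennreal (1 / sqrt (2 * pi)))"

text \<open>
  Conditional densities are functions \<open>g x y\<close>, standing for $g(y | x)$, and are taken
  with respect to \<open>ref_measure\<close>; this is why \<open>gauss_lin\<close> has no normalizing factor.
\<close>

definition gauss_lin :: "real ^ 'd \<Rightarrow> real ^ 'd \<Rightarrow> real \<Rightarrow> real" where
  "gauss_lin \<theta> x y = exp (- (1/2) * (y - \<theta> \<bullet> x)\<^sup>2)"

lemma density_gauss_lin:
  "density ref_measure (\<lambda>y. ennreal (gauss_lin \<theta> x y)) =
   density lborel (\<lambda>y. ennreal (normal_density (\<theta> \<bullet> x) 1 y))"
proof -
  have "ennreal (1 / sqrt (2 * pi)) * ennreal (gauss_lin \<theta> x y)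
        = ennreal (normal_density (\<theta> \<bullet> x) 1 y)" for y
    by (subst ennreal_mult[symmetric]) (simp_all add: gauss_lin_def normal_density_def)
  moreover have "(\<lambda>y. ennreal (gauss_lin \<theta> x y)) \<in> borel_measurable lborel"
    unfolding gauss_lin_def by measurable
  ultimately show ?thesis
    unfolding ref_measure_def by (subst density_density_eq) simp_all
qed

definition risk ::
  "'a measure \<Rightarrow> ('a \<Rightarrow> real ^ 'd) \<Rightarrow> ('a \<Rightarrow> real) \<Rightarrow> (real ^ 'd \<Rightarrow> real \<Rightarrow> real) \<Rightarrow> real" where
  "risk M X Y g = (\<integral>\<omega>. - ln (g (X \<omega>) (Y \<omega>)) \<partial>M)"

text \<open>
  The sample is \<open>(xs 1, ys 1), \<dots>, (xs n, ys n)\<close>; other indices are ignored. For \<open>lam > 0\<close> the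
  objective is strictly convex and coercive, so the minimizer exists and is unique.
\<close>

definition ridge_est ::
  "real \<Rightarrow> nat \<Rightarrow> (nat \<Rightarrow> real ^ 'd) \<Rightarrow> (nat \<Rightarrow> real) \<Rightarrow> real ^ 'd \<Rightarrow> real \<Rightarrow> real ^ 'd" where
  "ridge_est lam n xs ys x y =
     arg_min (\<lambda>\<theta>. (\<Sum>i=1..n. 1/2 * (ys i - \<theta> \<bullet> xs i)\<^sup>2) + 1/2 * (y - \<theta> \<bullet> x)\<^sup>2
                    + (real n + 1) * (lam / 2) * (norm \<theta>)\<^sup>2) (\<lambda>_. True)"

definition smp_unnormalized ::
  "real \<Rightarrow> nat \<Rightarrow> (nat \<Rightarrow> real ^ 'd) \<Rightarrow> (nat \<Rightarrow> real) \<Rightarrow> real ^ 'd \<Rightarrow> real \<Rightarrow> real" where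
  "smp_unnormalized lam n xs ys x y =
     gauss_lin (ridge_est lam n xs ys x y) x y
       * exp (- lam * (norm (ridge_est lam n xs ys x y))\<^sup>2 / 2)"

definition smp ::
  "real \<Rightarrow> nat \<Rightarrow> (nat \<Rightarrow> real ^ 'd) \<Rightarrow> (nat \<Rightarrow> real) \<Rightarrow> real ^ 'd \<Rightarrow> real \<Rightarrow> real" where
  "smp lam n xs ys x y =
     smp_unnormalized lam n xs ys x y
       / (\<integral>y'. smp_unnormalized lam n xs ys x y' \<partial>ref_measure)"

end

theory Submission
  imports Defs
begin

text \<open>
  Write \<open>A\<close> for the ridge operator \<open>\<Sum>i. x i x i\<^sup>T + c\<close> of the full sample of size \<open>N = n + 1\<close>,
  with \<open>c = N \<lambda> = d / B\<^sup>2\<close>, and \<open>h k = x k\<^sup>T A\<^sup>-\<^sup>1 x k\<close> for the leverages. The logarithmic loss of the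
  predictor is the regularized loss of the full ridge estimator at the test point plus the
  logarithm of the normalizer. The sample together with the test point is exchangeable, so the first
  term has the expectation of \<open>1 / N\<close> times the minimal ridge objective, which is at most
  \<open>\<R>(f\<^sub>\<theta>) + \<lambda> \<parallel>\<theta>\<parallel>\<^sup>2 / 2\<close>. The residual at the test point is affine in the label with slope \<open>1 - h\<close>, so
  the normalizer is at most \<open>1 / (1 - h)\<close>. Since \<open>h \<le> R\<^sup>2 / (c + R\<^sup>2)\<close>, we get
  \<open>- ln (1 - h) \<le> h (1 + ln (1 + R\<^sup>2 / c))\<close>, and by exchangeability the expectation of \<open>h\<close> is at most
  \<open>d / N\<close>, because the leverages add up to at most \<open>d\<close>.
\<close>

section \<open>The ridge operator, its inverse and the leverages\<close>

definition ridge_op :: "real \<Rightarrow> 'i set \<Rightarrow> ('i \<Rightarrow> 'b::euclidean_space) \<Rightarrow> 'b \<Rightarrow> 'b" where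
  "ridge_op c I x v = (\<Sum>i\<in>I. (x i \<bullet> v) *\<^sub>R x i) + c *\<^sub>R v"

text \<open>\<open>inv\<close> merely picks preimages. It is a genuine inverse once
  \<open>c > 0\<close>: the quadratic form then dominates \<open>c * (norm u)^2\<close>, so the
  operator is injective and, in finite dimension, also surjective.\<close>

definition ridge_inv :: "real \<Rightarrow> 'i set \<Rightarrow> ('i \<Rightarrow> 'b::euclidean_space) \<Rightarrow> 'b \<Rightarrow> 'b" where
  "ridge_inv c I x = inv (ridge_op c I x)"

definition leverage :: "real \<Rightarrow> 'i set \<Rightarrow> ('i \<Rightarrow> 'b::euclidean_space) \<Rightarrow> 'i \<Rightarrow> real" where
  "leverage c I x k = x k \<bullet> ridge_inv c I x (x k)"

lemma linear_ridge_op: "linear (ridge_op c I x)"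
  by (rule linearI)
     (simp_all add: ridge_op_def inner_add_right scaleR_add_left scaleR_add_right sum.distrib
        scaleR_sum_right mult.commute)

lemma inner_ridge_op:
  "u \<bullet> ridge_op c I x v = (\<Sum>i\<in>I. (x i \<bullet> u) * (x i \<bullet> v)) + c * (u \<bullet> v)"
  by (simp add: ridge_op_def inner_add_right inner_sum_right inner_commute mult.commute)

lemma ridge_op_pos: "u \<bullet> ridge_op c I x u \<ge> c * (norm u)\<^sup>2"
  by (simp add: inner_ridge_op sum_nonneg dot_square_norm)

lemma inj_ridge_op:
  assumes "c > 0"
  shows "inj (ridge_op c I x)"
proof -
  have "u = 0" if "ridge_op c I x u = 0" for u
  proof -
    have "c * (norm u)\<^sup>2 \<le> 0"
      using ridge_op_pos[of c u I x] that by simp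
    then show ?thesis
      using assms by (simp add: mult_le_0_iff)
  qed
  then show ?thesis
    by (simp add: linear_injective_0[OF linear_ridge_op])
qed

context
  fixes c :: real
  assumes c: "c > 0"
begin

lemma surj_ridge_op: "surj (ridge_op c I x)"
  by (intro linear_inj_imp_surj linear_ridge_op inj_ridge_op c)

lemma ridge_op_inv [simp]: "ridge_op c I x (ridge_inv c I x w) = w"
  unfolding ridge_inv_def by (rule surj_f_inv_f[OF surj_ridge_op])

lemma ridge_inv_eqI: "ridge_op c I x v = w \<Longrightarrow> ridge_inv c I x w = v"
  unfolding ridge_inv_def by (rule inv_f_eq[OF inj_ridge_op[OF c]])

lemma linear_ridge_inv: "linear (ridge_inv c I x)"
proof -
  interpret linear "ridge_op c I x"
    by (rule linear_ridge_op)
  show ?thesis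
    by (rule linearI) (auto intro!: ridge_inv_eqI simp: add scale)
qed

text \<open>Writing \<open>u\<close> as the operator applied to its own preimage lets
  self-adjointness carry the operator over to the other factor, where it cancels the
  inverse.\<close>

lemma ridge_inv_symmetric: "u \<bullet> ridge_inv c I x w = ridge_inv c I x u \<bullet> w"
proof -
  have "u \<bullet> ridge_inv c I x w = ridge_op c I x (ridge_inv c I x u) \<bullet> ridge_inv c I x w"
    by simp
  also have "\<dots> = ridge_inv c I x u \<bullet> ridge_op c I x (ridge_inv c I x w)"
    by (subst (1) inner_commute) (simp only: inner_ridge_op inner_commute mult.commute)
  finally show ?thesis
    by simp
qed

lemma ridge_inv_nonneg: "w \<bullet> ridge_inv c I x w \<ge> 0"
proof -
  have "0 \<le> c * (norm (ridge_inv c I x w))\<^sup>2"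
    using c by simp
  also have "\<dots> \<le> ridge_inv c I x w \<bullet> ridge_op c I x (ridge_inv c I x w)"
    by (rule ridge_op_pos)
  finally show ?thesis
    by (simp add: inner_commute)
qed

lemma leverage_nonneg: "leverage c I x k \<ge> 0"
  unfolding leverage_def by (rule ridge_inv_nonneg)

text \<open>With \<open>v\<close> the preimage of \<open>x k\<close>, the leverage \<open>h\<close>
  equals the quadratic form at \<open>v\<close>. Keeping only the \<open>k\<close>-th term of its
  sum gives \<open>h^2 + c * (norm v)^2 <= h\<close>, and Cauchy-Schwarz gives
  \<open>h <= r * norm v\<close>. Eliminating \<open>norm v\<close> leaves
  \<open>c * h^2 <= r^2 * (h - h^2)\<close>, to be divided by \<open>h\<close> unless
  \<open>h = 0\<close>.\<close>

lemma leverage_le: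
  assumes "finite I" "k \<in> I" "norm (x k) \<le> r"
  shows "leverage c I x k * (c + r\<^sup>2) \<le> r\<^sup>2"
proof -
  define v where "v = ridge_inv c I x (x k)"
  define h where "h = leverage c I x k"
  have h: "h = x k \<bullet> v" "h \<ge> 0"
    using leverage_nonneg by (simp_all add: h_def v_def leverage_def)
  have "h\<^sup>2 = (x k \<bullet> v) * (x k \<bullet> v)"
    by (simp add: h power2_eq_square)
  also have "\<dots> \<le> (\<Sum>i\<in>I. (x i \<bullet> v) * (x i \<bullet> v))"
    using assms by (intro member_le_sum) auto
  also have "\<dots> = v \<bullet> ridge_op c I x v - c * (norm v)\<^sup>2"
    by (simp add: inner_ridge_op dot_square_norm)
  also have "\<dots> = h - c * (norm v)\<^sup>2"
    by (simp add: h v_def inner_commute)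
  finally have 1: "h\<^sup>2 + c * (norm v)\<^sup>2 \<le> h"
    by simp
  have "h\<^sup>2 \<le> (norm (x k) * norm v)\<^sup>2"
    using h norm_cauchy_schwarz[of "x k" v] by (intro power_mono) auto
  also have "\<dots> \<le> (r * norm v)\<^sup>2"
    using assms(3) by (intro power_mono mult_right_mono) auto
  finally have "c * h\<^sup>2 \<le> r\<^sup>2 * (c * (norm v)\<^sup>2)"
    using c by (simp add: power_mult_distrib)
  also have "\<dots> \<le> r\<^sup>2 * (h - h\<^sup>2)"
    using 1 by (intro mult_left_mono) auto
  finally have "h * (h * (c + r\<^sup>2)) \<le> h * r\<^sup>2"
    by (simp add: algebra_simps power2_eq_square)
  then show ?thesis
    using h(2) by (cases "h = 0") (auto simp: h_def[symmetric])
qed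

lemma leverage_less_1:
  assumes "finite I" "k \<in> I"
  shows "leverage c I x k < 1"
proof (rule ccontr)
  assume "\<not> ?thesis"
  then have "1 * (c + (norm (x k))\<^sup>2) \<le> leverage c I x k * (c + (norm (x k))\<^sup>2)"
    using c by (intro mult_right_mono) auto
  then show False
    using leverage_le[OF assms order.refl, of x] c by simp
qed

text \<open>A rearrangement of \<open>leverage_le\<close>: it says that \<open>1 - h\<close> is at
  least \<open>c / (c + r^2)\<close>.\<close>

lemma ln_leverage_le:
  assumes "finite I" "k \<in> I" "norm (x k) \<le> r"
  shows "- ln (1 - leverage c I x k) \<le> ln (1 + r\<^sup>2 / c)"
proof -
  have "1 - leverage c I x k > 0"
    using leverage_less_1[OF assms(1,2)] by simp
  then have "- ln (1 - leverage c I x k) = ln (1 / (1 - leverage c I x k))"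
    by (simp add: ln_div)
  also have "1 / (1 - leverage c I x k) \<le> 1 + r\<^sup>2 / c"
    using leverage_le[of I k x r] assms c \<open>1 - leverage c I x k > 0\<close> by (simp add: field_simps)
  then have "ln (1 / (1 - leverage c I x k)) \<le> ln (1 + r\<^sup>2 / c)"
    using \<open>1 - leverage c I x k > 0\<close> c by (subst ln_le_cancel_iff) (auto intro!: add_pos_nonneg)
  finally show ?thesis .
qed

text \<open>A bound linear in the leverage is wanted, since only the mean of the leverage is
  controlled. For \<open>u = 1 - h\<close>, multiplying \<open>ln (1 / u) <= 1 / u - 1\<close> by
  \<open>u\<close> gives \<open>- u * ln u <= 1 - u\<close>, that is
  \<open>- ln u <= (1 - u) * (1 - ln u)\<close>. The uniform bound \<open>ln_leverage_le\<close> is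
  then inserted in the last factor.\<close>

lemma ln_leverage_le_linear:
  assumes "finite I" "k \<in> I" "norm (x k) \<le> r"
  shows "- ln (1 - leverage c I x k) \<le> leverage c I x k * (1 + ln (1 + r\<^sup>2 / c))"
proof -
  define u where "u = 1 - leverage c I x k"
  have u: "u > 0"
    using leverage_less_1[OF assms(1,2)] by (simp add: u_def)
  have "ln (1 / u) \<le> 1 / u - 1"
    using u by (intro ln_le_minus_one) auto
  then have "- ln u * u \<le> (1 / u - 1) * u"
    using u by (intro mult_right_mono) (auto simp: ln_div)
  also have "\<dots> = 1 - u"
    using u by (simp add: field_simps)
  finally have "- ln u \<le> (1 - u) * (1 - ln u)"
    by (simp add: algebra_simps)
  also have "\<dots> \<le> (1 - u) * (1 + ln (1 + r\<^sup>2 / c))"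
    using ln_leverage_le[of I k x r] assms leverage_nonneg by (intro mult_left_mono) (auto simp: u_def)
  finally show ?thesis
    by (simp add: u_def)
qed

text \<open>The sum is the trace of \<open>(\<Sum>i. x i x i\<^sup>T) A\<^sup>-\<^sup>1 = 1 - c A\<^sup>-\<^sup>1\<close>, where \<open>A\<close> is the ridge operator.\<close>

lemma sum_leverage_le:
  fixes x :: "'i \<Rightarrow> 'b::euclidean_space"
  shows "(\<Sum>k\<in>I. leverage c I x k) \<le> DIM('b)"
proof -
  have "(\<Sum>k\<in>I. leverage c I x k) = (\<Sum>k\<in>I. \<Sum>e\<in>Basis. (x k \<bullet> e) * (x k \<bullet> ridge_inv c I x e))"
    unfolding leverage_def
    by (intro sum.cong refl, subst euclidean_inner) (simp only: ridge_inv_symmetric)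
  also have "\<dots> = (\<Sum>e\<in>Basis. \<Sum>k\<in>I. (x k \<bullet> e) * (x k \<bullet> ridge_inv c I x e))"
    by (rule sum.swap)
  also have "\<dots> \<le> (\<Sum>e\<in>(Basis :: 'b set). 1)"
  proof (intro sum_mono)
    fix e :: 'b assume "e \<in> Basis"
    then have "1 = e \<bullet> ridge_op c I x (ridge_inv c I x e)"
      by simp
    also have "\<dots> = (\<Sum>k\<in>I. (x k \<bullet> e) * (x k \<bullet> ridge_inv c I x e)) + c * (e \<bullet> ridge_inv c I x e)"
      by (simp only: inner_ridge_op)
    finally show "(\<Sum>k\<in>I. (x k \<bullet> e) * (x k \<bullet> ridge_inv c I x e)) \<le> 1"
      using c ridge_inv_nonneg[of e I x] by (smt (verit) mult_nonneg_nonneg)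
  qed
  finally show ?thesis
    by simp
qed

end

section \<open>Reindexing and measurability of the inverse\<close>

lemma ridge_inv_cong: "(\<And>i. i \<in> I \<Longrightarrow> x i = x' i) \<Longrightarrow> ridge_inv c I x = ridge_inv c I x'"
  unfolding ridge_inv_def ridge_op_def by (intro arg_cong[of _ _ inv] ext) (simp cong: sum.cong)

lemma ridge_inv_reindex: "bij_betw p I I \<Longrightarrow> ridge_inv c I (\<lambda>i. x (p i)) = ridge_inv c I x"
  unfolding ridge_inv_def ridge_op_def
  by (intro arg_cong[of _ _ inv] ext)
     (simp add: sum.reindex_bij_betw[of p I I "\<lambda>i. (x i \<bullet> _) *\<^sub>R x i"])

text \<open>This equivariance under permutations of the data is what
  \<open>integral_PiM_exchangeable\<close> asks for in its hypothesis \<open>perm\<close>.\<close>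

lemma leverage_reindex: "bij_betw p I I \<Longrightarrow> leverage c I (\<lambda>i. x (p i)) k = leverage c I x (p k)"
  by (simp add: leverage_def ridge_inv_reindex)

text \<open>The definition through \<open>inv\<close> says nothing about measurability. Cramer's
  rule, valid because the operator is injective, writes each coordinate as a quotient of two
  determinants, which are polynomials in measurable entries. The matrix \<open>A\<close> represents
  the operator in coordinates.\<close>

lemma measurable_ridge_inv:
  fixes x :: "'i \<Rightarrow> 'a \<Rightarrow> real ^ 'd" and w :: "'a \<Rightarrow> real ^ 'd"
  assumes "c > 0" "finite I"
  assumes [measurable]: "\<And>i. i \<in> I \<Longrightarrow> x i \<in> borel_measurable N" "w \<in> borel_measurable N"
  shows "(\<lambda>\<omega>. ridge_inv c I (\<lambda>i. x i \<omega>) (w \<omega>)) \<in> borel_measurable N"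
proof -
  define A :: "'a \<Rightarrow> real ^ 'd ^ 'd" where
    "A \<omega> = (\<chi> i j. (\<Sum>k\<in>I. x k \<omega> $ i * x k \<omega> $ j) + (if i = j then c else 0))" for \<omega>
  have A: "A \<omega> *v v = ridge_op c I (\<lambda>i. x i \<omega>) v" for \<omega> v
  proof -
    have "(A \<omega> *v v) $ i = ridge_op c I (\<lambda>i. x i \<omega>) v $ i" for i
    proof -
      have "(A \<omega> *v v) $ i = (\<Sum>j\<in>UNIV. (\<Sum>k\<in>I. x k \<omega> $ i * x k \<omega> $ j * v $ j)) +
          (\<Sum>j\<in>UNIV. if i = j then c * v $ j else 0)"
        by (simp add: A_def matrix_vector_mult_def distrib_right sum.distrib sum_distrib_right
            if_distrib[of "\<lambda>a. a * _"] cong: if_cong)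
      also have "\<dots> = ridge_op c I (\<lambda>i. x i \<omega>) v $ i"
        by (subst sum.swap) (simp add: ridge_op_def inner_vec_def sum_distrib_left sum_distrib_right mult_ac)
      finally show ?thesis .
    qed
    then show ?thesis
      by (simp add: vec_eq_iff)
  qed
  have det: "det (A \<omega>) \<noteq> 0" for \<omega>
  proof -
    have "inj ((*v) (A \<omega>))"
      unfolding A by (rule inj_ridge_op[OF \<open>c > 0\<close>])
    then show ?thesis
      by (metis invertible_det_nz invertible_left_inverse matrix_left_invertible_injective)
  qed
  have [measurable]: "(\<lambda>\<omega>. w \<omega> $ i) \<in> borel_measurable N" for i
    unfolding cart_eq_inner_axis by measurable
  have [measurable]: "k \<in> I \<Longrightarrow> (\<lambda>\<omega>. x k \<omega> $ i) \<in> borel_measurable N" for i k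
    unfolding cart_eq_inner_axis by measurable
  have A_measurable: "(\<lambda>\<omega>. A \<omega> $ i $ j) \<in> borel_measurable N" for i j
    unfolding A_def by simp
  have det_measurable: "(\<lambda>\<omega>. det (D \<omega>)) \<in> borel_measurable N"
    if "\<And>i j. (\<lambda>\<omega>. D \<omega> $ i $ j) \<in> borel_measurable N" for D :: "'a \<Rightarrow> real ^ 'd ^ 'd"
    unfolding det_def
    by (intro borel_measurable_sum borel_measurable_times borel_measurable_prod that) auto
  have "(\<lambda>\<omega>. ridge_inv c I (\<lambda>i. x i \<omega>) (w \<omega>) $ k) \<in> borel_measurable N" for k
  proof -
    have "ridge_inv c I (\<lambda>i. x i \<omega>) (w \<omega>) $ k =
        det (\<chi> i j. if j = k then w \<omega> $ i else A \<omega> $ i $ j) / det (A \<omega>)" for \<omega>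
      using cramer[OF det[of \<omega>], of "ridge_inv c I (\<lambda>i. x i \<omega>) (w \<omega>)" "w \<omega>"]
      by (simp add: A ridge_op_inv \<open>c > 0\<close>)
    moreover have "(\<lambda>\<omega>. (\<chi> i j. if j = k then w \<omega> $ i else A \<omega> $ i $ j) $ i $ j) \<in> borel_measurable N"
      for i j
      by (cases "j = k") (simp_all add: A_measurable)
    ultimately show ?thesis
      using det_measurable A_measurable by (auto intro!: borel_measurable_divide)
  qed
  then show ?thesis
    by (subst borel_measurable_euclidean_space) (auto simp: Basis_vec_def inner_axis)
qed

section \<open>The ridge estimator, its losses and the normalizer\<close>

definition ridge_obj :: "real \<Rightarrow> 'i set \<Rightarrow> ('i \<Rightarrow> 'b::euclidean_space \<times> real) \<Rightarrow> 'b \<Rightarrow> real" where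
  "ridge_obj c I z \<theta> = (\<Sum>i\<in>I. 1/2 * (snd (z i) - \<theta> \<bullet> fst (z i))\<^sup>2) + c / 2 * (norm \<theta>)\<^sup>2"

definition ridge :: "real \<Rightarrow> 'i set \<Rightarrow> ('i \<Rightarrow> 'b::euclidean_space \<times> real) \<Rightarrow> 'b" where
  "ridge c I z = ridge_inv c I (\<lambda>i. fst (z i)) (\<Sum>i\<in>I. snd (z i) *\<^sub>R fst (z i))"

text \<open>Here \<open>c\<close> is the total penalty used in the fit and \<open>lam\<close> the
  share charged to one observation. For \<open>lam = c / card I\<close> the shares add up to the
  objective, see \<open>sum_ridge_loss\<close>.\<close>

definition ridge_loss ::
  "real \<Rightarrow> real \<Rightarrow> 'i set \<Rightarrow> ('i \<Rightarrow> 'b::euclidean_space \<times> real) \<Rightarrow> 'i \<Rightarrow> real" where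
  "ridge_loss lam c I z k =
     1/2 * (snd (z k) - ridge c I z \<bullet> fst (z k))\<^sup>2 + lam / 2 * (norm (ridge c I z))\<^sup>2"

text \<open>Observation \<open>k\<close> plays the test point. Its label is overwritten by the
  integration variable, and the estimator is refitted for each value of it.\<close>

definition ridge_norm ::
  "real \<Rightarrow> real \<Rightarrow> 'i set \<Rightarrow> ('i \<Rightarrow> 'b::euclidean_space \<times> real) \<Rightarrow> 'i \<Rightarrow> real" where
  "ridge_norm lam c I z k =
     (\<integral>y. exp (- ridge_loss lam c I (z(k := (fst (z k), y))) k) \<partial>ref_measure)"

lemma borel_measurable_fst_snd:
  fixes f :: "'a \<Rightarrow> 'b::topological_space \<times> 'c::topological_space"
  assumes "f \<in> borel_measurable N"
  shows "(\<lambda>\<omega>. fst (f \<omega>)) \<in> borel_measurable N" "(\<lambda>\<omega>. snd (f \<omega>)) \<in> borel_measurable N"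
  using assms
  by (auto intro!: measurable_compose[OF assms] borel_measurable_continuous_onI continuous_intros)

lemma ridge_obj_quadratic:
  "ridge_obj c I z \<theta> = (\<Sum>i\<in>I. 1/2 * (snd (z i))\<^sup>2) - \<theta> \<bullet> (\<Sum>i\<in>I. snd (z i) *\<^sub>R fst (z i))
     + 1/2 * (\<theta> \<bullet> ridge_op c I (\<lambda>i. fst (z i)) \<theta>)"
proof -
  have "1/2 * (snd (z i) - \<theta> \<bullet> fst (z i))\<^sup>2 = 1/2 * (snd (z i))\<^sup>2 - snd (z i) * (\<theta> \<bullet> fst (z i))
      + 1/2 * ((fst (z i) \<bullet> \<theta>) * (fst (z i) \<bullet> \<theta>))" for i
    by (simp add: power2_eq_square algebra_simps inner_commute)
  then have "ridge_obj c I z \<theta> = (\<Sum>i\<in>I. 1/2 * (snd (z i))\<^sup>2 - snd (z i) * (\<theta> \<bullet> fst (z i))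
      + 1/2 * ((fst (z i) \<bullet> \<theta>) * (fst (z i) \<bullet> \<theta>))) + c / 2 * (norm \<theta>)\<^sup>2"
    unfolding ridge_obj_def by presburger
  then show ?thesis
    by (simp add: inner_ridge_op sum.distrib sum_subtractf inner_sum_right
        sum_distrib_left dot_square_norm algebra_simps)
qed

context
  fixes c :: real
  assumes c: "c > 0"
begin

lemma ridge_op_ridge: "ridge_op c I (\<lambda>i. fst (z i)) (ridge c I z) = (\<Sum>i\<in>I. snd (z i) *\<^sub>R fst (z i))"
  by (simp add: ridge_def ridge_op_inv[OF c])

text \<open>The second-order expansion around \<open>ridge c I z\<close> is exact because the
  objective is quadratic, and the linear term vanishes by the normal equations
  \<open>ridge_op_ridge\<close>.\<close>

lemma ridge_obj_eq:
  "ridge_obj c I z \<theta> = ridge_obj c I z (ridge c I z)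
     + 1/2 * ((\<theta> - ridge c I z) \<bullet> ridge_op c I (\<lambda>i. fst (z i)) (\<theta> - ridge c I z))"
proof -
  let ?A = "ridge_op c I (\<lambda>i. fst (z i))"
  let ?r = "ridge c I z"
  have sym: "\<theta> \<bullet> ?A ?r = ?r \<bullet> ?A \<theta>"
    by (simp only: inner_ridge_op inner_commute mult.commute)
  have diff: "?A (\<theta> - ?r) = ?A \<theta> - ?A ?r"
    by (rule linear_diff[OF linear_ridge_op])
  show ?thesis
    unfolding ridge_obj_quadratic ridge_op_ridge[symmetric] diff
    using sym by (simp add: algebra_simps)
qed

lemma ridge_obj_ge: "ridge_obj c I z \<theta> \<ge> ridge_obj c I z (ridge c I z) + c / 2 * (norm (\<theta> - ridge c I z))\<^sup>2"
  using ridge_op_pos[of c "\<theta> - ridge c I z" I "\<lambda>i. fst (z i)"] by (subst ridge_obj_eq) simp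

lemma ridge_obj_min: "ridge_obj c I z (ridge c I z) \<le> ridge_obj c I z \<theta>"
proof -
  have "0 \<le> c / 2 * (norm (\<theta> - ridge c I z))\<^sup>2"
    using c by simp
  then show ?thesis
    using ridge_obj_ge[of I z \<theta>] by linarith
qed

text \<open>\<open>arg_min\<close> is a choice among minimizers, so uniqueness is needed: a point
  with the minimal value has distance zero from \<open>ridge c I z\<close> by the quadratic growth
  in \<open>ridge_obj_ge\<close>.\<close>

lemma arg_min_ridge_obj: "arg_min (ridge_obj c I z) (\<lambda>_. True) = ridge c I z"
proof -
  let ?m = "arg_min (ridge_obj c I z) (\<lambda>_. True)"
  have "ridge_obj c I z ?m = ridge_obj c I z (ridge c I z)"
    by (rule arg_min_equality) (auto intro: ridge_obj_min)
  then have "c / 2 * (norm (?m - ridge c I z))\<^sup>2 \<le> 0"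
    using ridge_obj_ge[of I z ?m] by simp
  then show ?thesis
    using c by (simp add: mult_le_0_iff)
qed

lemma ridge_cong: "(\<And>i. i \<in> I \<Longrightarrow> z i = z' i) \<Longrightarrow> ridge c I z = ridge c I z'"
  unfolding ridge_def by (subst ridge_inv_cong[where x'="\<lambda>i. fst (z' i)"]) (auto cong: sum.cong)

lemma ridge_reindex: "bij_betw p I I \<Longrightarrow> ridge c I (\<lambda>i. z (p i)) = ridge c I z"
  unfolding ridge_def
  by (simp add: ridge_inv_reindex[of p I c "\<lambda>i. fst (z i)"] sum.reindex_bij_betw[of p I I "\<lambda>i. snd (z i) *\<^sub>R fst (z i)"])

lemma ridge_loss_reindex: "bij_betw p I I \<Longrightarrow> ridge_loss lam c I (\<lambda>i. z (p i)) k = ridge_loss lam c I z (p k)"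
  by (simp add: ridge_loss_def ridge_reindex)

text \<open>Points of a product space are \<open>undefined\<close> outside \<open>I\<close>, while
  permuted and updated families need not be; only the coordinates in \<open>I\<close>
  matter.\<close>

lemma ridge_loss_cong:
  "(\<And>i. i \<in> I \<Longrightarrow> z i = z' i) \<Longrightarrow> k \<in> I \<Longrightarrow> ridge_loss lam c I z k = ridge_loss lam c I z' k"
  unfolding ridge_loss_def using ridge_cong[of I z z'] by simp

lemma sum_ridge_loss:
  "(\<Sum>k\<in>I. ridge_loss (c / card I) c I z k) = ridge_obj c I z (ridge c I z)" if "finite I" "I \<noteq> {}"
  using that by (simp add: ridge_loss_def ridge_obj_def sum.distrib)

lemma ridge_loss_nonneg: "lam \<ge> 0 \<Longrightarrow> ridge_loss lam c I z k \<ge> 0"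
  by (simp add: ridge_loss_def)

text \<open>One loss is at most the whole minimal objective, and hence at most the objective at the
  zero vector. This gives a dominating function that is free of the covariates.\<close>

lemma ridge_loss_le:
  assumes "finite I" "k \<in> I" "lam \<le> c"
  shows "ridge_loss lam c I z k \<le> (\<Sum>i\<in>I. 1/2 * (snd (z i))\<^sup>2)"
proof -
  have "ridge_loss lam c I z k \<le> ridge_obj c I z (ridge c I z)"
    unfolding ridge_loss_def ridge_obj_def using assms
    by (intro add_mono member_le_sum mult_right_mono) auto
  also have "\<dots> \<le> ridge_obj c I z 0"
    by (rule ridge_obj_min)
  finally show ?thesis
    by (simp add: ridge_obj_def)
qed

text \<open>The operator depends on the covariates only, and the label of \<open>k\<close> enters
  the right-hand side of the normal equations in a single summand. The estimator is therefore affine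
  in \<open>y\<close>, and its prediction at \<open>k\<close> has slope equal to the
  leverage.\<close>

lemma ridge_residual:
  assumes "finite I" "k \<in> I"
  shows "y - ridge c I (z(k := (fst (z k), y))) \<bullet> fst (z k) =
     (1 - leverage c I (\<lambda>i. fst (z i)) k) * y - ridge c I (z(k := (fst (z k), 0))) \<bullet> fst (z k)"
proof -
  let ?G = "ridge_inv c I (\<lambda>i. fst (z i))"
  define b where "b = (\<Sum>i\<in>I - {k}. snd (z i) *\<^sub>R fst (z i))"
  have fst_upd: "(\<lambda>i. fst ((z(k := (fst (z k), y))) i)) = (\<lambda>i. fst (z i))" for y
    by auto
  have "ridge c I (z(k := (fst (z k), y))) = ?G (b + y *\<^sub>R fst (z k))" for y
    unfolding ridge_def fst_upd b_def using assms
    by (simp add: sum.remove[of I k] add.commute)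
  then have "ridge c I (z(k := (fst (z k), y))) = ?G b + y *\<^sub>R ?G (fst (z k))" for y
    using linear_ridge_inv[OF c, of I "\<lambda>i. fst (z i)"] by (simp add: linear_add linear_scale)
  then show ?thesis
    by (simp add: leverage_def algebra_simps inner_commute)
qed

lemma measurable_ridge:
  fixes z :: "'i \<Rightarrow> 'a \<Rightarrow> (real ^ 'd) \<times> real"
  assumes "finite I" and [measurable]: "\<And>i. i \<in> I \<Longrightarrow> z i \<in> borel_measurable N"
  shows "(\<lambda>\<omega>. ridge c I (\<lambda>i. z i \<omega>)) \<in> borel_measurable N"
proof -
  have [measurable]: "i \<in> I \<Longrightarrow> (\<lambda>\<omega>. fst (z i \<omega>)) \<in> borel_measurable N"
    "i \<in> I \<Longrightarrow> (\<lambda>\<omega>. snd (z i \<omega>)) \<in> borel_measurable N" for i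
    by (auto intro: borel_measurable_fst_snd)
  show ?thesis
    unfolding ridge_def by (rule measurable_ridge_inv[OF c \<open>finite I\<close>]) measurable
qed

lemma measurable_ridge_loss:
  fixes z :: "'i \<Rightarrow> 'a \<Rightarrow> (real ^ 'd) \<times> real"
  assumes "finite I" "k \<in> I" and [measurable]: "\<And>i. i \<in> I \<Longrightarrow> z i \<in> borel_measurable N"
  shows "(\<lambda>\<omega>. ridge_loss lam c I (\<lambda>i. z i \<omega>) k) \<in> borel_measurable N"
proof -
  have [measurable]: "(\<lambda>\<omega>. fst (z k \<omega>)) \<in> borel_measurable N" "(\<lambda>\<omega>. snd (z k \<omega>)) \<in> borel_measurable N"
    using \<open>k \<in> I\<close> by (auto intro: borel_measurable_fst_snd)
  have [measurable]: "(\<lambda>\<omega>. ridge c I (\<lambda>i. z i \<omega>)) \<in> borel_measurable N"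
    by (rule measurable_ridge[OF assms(1,3)])
  show ?thesis
    unfolding ridge_loss_def by measurable
qed

lemma measurable_leverage:
  fixes z :: "'i \<Rightarrow> 'a \<Rightarrow> (real ^ 'd) \<times> real"
  assumes "finite I" "k \<in> I" and [measurable]: "\<And>i. i \<in> I \<Longrightarrow> z i \<in> borel_measurable N"
  shows "(\<lambda>\<omega>. leverage c I (\<lambda>i. fst (z i \<omega>)) k) \<in> borel_measurable N"
proof -
  have [measurable]: "i \<in> I \<Longrightarrow> (\<lambda>\<omega>. fst (z i \<omega>)) \<in> borel_measurable N" for i
    by (auto intro: borel_measurable_fst_snd)
  have [measurable]: "(\<lambda>\<omega>. ridge_inv c I (\<lambda>i. fst (z i \<omega>)) (fst (z k \<omega>))) \<in> borel_measurable N"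
    using assms by (intro measurable_ridge_inv[OF c \<open>finite I\<close>]) measurable
  show ?thesis
    unfolding leverage_def using \<open>k \<in> I\<close> by measurable
qed

text \<open>Joint measurability in the data and the label is what makes the normalizer, a
  parametrized integral, measurable.\<close>

lemma measurable_ridge_loss_update:
  fixes z :: "'i \<Rightarrow> 'a \<Rightarrow> (real ^ 'd) \<times> real"
  assumes "finite I" "k \<in> I" and [measurable]: "\<And>i. i \<in> I \<Longrightarrow> z i \<in> borel_measurable N"
  shows "(\<lambda>(\<omega>, y). ridge_loss lam c I ((\<lambda>i. z i \<omega>)(k := (fst (z k \<omega>), y))) k)
    \<in> borel_measurable (N \<Otimes>\<^sub>M borel)"
proof -
  have "(\<lambda>p. ridge_loss lam c I
      (\<lambda>i. if i = k then (fst (z k (fst p)), snd p) else z i (fst p)) k) \<in> borel_measurable (N \<Otimes>\<^sub>M borel)"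
  proof (rule measurable_ridge_loss[OF assms(1,2)])
    fix i assume [measurable]: "i \<in> I"
    have [measurable]: "(\<lambda>\<omega>. fst (z k \<omega>)) \<in> borel_measurable N"
      using \<open>k \<in> I\<close> by (auto intro: borel_measurable_fst_snd)
    show "(\<lambda>p. if i = k then (fst (z k (fst p)), snd p) else z i (fst p)) \<in> borel_measurable (N \<Otimes>\<^sub>M borel)"
      using \<open>i \<in> I\<close> by measurable
  qed
  then show ?thesis
    by (simp add: case_prod_beta' fun_upd_def)
qed

lemma integral_ref_measure:
  assumes "f \<in> borel_measurable borel"
  shows "(\<integral>y. f y \<partial>ref_measure) = (\<integral>y. f y / sqrt (2 * pi) \<partial>lborel)"
  unfolding ref_measure_def using assms by (subst integral_density) (auto simp: field_simps)

lemma measurable_ridge_norm: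
  fixes z :: "'i \<Rightarrow> 'a \<Rightarrow> (real ^ 'd) \<times> real"
  assumes "finite I" "k \<in> I" "\<And>i. i \<in> I \<Longrightarrow> z i \<in> borel_measurable N"
  shows "(\<lambda>\<omega>. ridge_norm lam c I (\<lambda>i. z i \<omega>) k) \<in> borel_measurable N"
proof -
  note [measurable] = measurable_ridge_loss_update[OF assms]
  have *: "(\<lambda>y. ridge_loss lam c I (w(k := (fst (w k), y))) k) \<in> borel_measurable borel"
    for w :: "'i \<Rightarrow> (real ^ 'd) \<times> real"
  proof -
    \<comment> \<open>Fixed data are viewed as a constant family over a dummy real parameter; the
      section at 0 then gives measurability in \<open>y\<close> alone.\<close>
    have "(\<lambda>(\<omega>, y). ridge_loss lam c I ((\<lambda>i. w i)(k := (fst (w k), y))) k) \<in> borel_measurable (borel \<Otimes>\<^sub>M borel)"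
      by (rule measurable_ridge_loss_update[OF assms(1,2)]) simp
    from measurable_Pair2[OF this, of "0::real"] show ?thesis by simp
  qed
  show ?thesis
    unfolding ridge_norm_def by (subst integral_ref_measure) (use * in measurable)
qed

text \<open>Upper bound: dropping the penalty leaves the residual
  \<open>u * y - m = u * (y - m / u)\<close>, so the integrand is at most \<open>1 / u\<close> times
  a normal density with standard deviation \<open>1 / u\<close>. Lower bound: by
  \<open>ridge_loss_le\<close> the loss is at most \<open>S + y^2 / 2\<close>, so the integrand is
  at least \<open>exp (- S)\<close> times the standard normal density. The lower bound yields
  positivity and control of the logarithm from below.\<close>

lemma ridge_norm_bounds:
  fixes z :: "'i \<Rightarrow> (real ^ 'd) \<times> real"
  assumes I: "finite I" "k \<in> I" and lam: "0 \<le> lam" "lam \<le> c"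
  shows "exp (- (\<Sum>i\<in>I - {k}. 1/2 * (snd (z i))\<^sup>2)) \<le> ridge_norm lam c I z k"
    and "ridge_norm lam c I z k \<le> 1 / (1 - leverage c I (\<lambda>i. fst (z i)) k)"
proof -
  let ?x = "fst (z k)"
  let ?g = "\<lambda>y. exp (- ridge_loss lam c I (z(k := (?x, y))) k) / sqrt (2 * pi)"
  define S where "S = (\<Sum>i\<in>I - {k}. 1/2 * (snd (z i))\<^sup>2)"
  define u where "u = 1 - leverage c I (\<lambda>i. fst (z i)) k"
  define m where "m = ridge c I (z(k := (?x, 0))) \<bullet> ?x"
  have u: "u > 0"
    using leverage_less_1[OF c I] by (simp add: u_def)
  have meas [measurable]: "(\<lambda>y. ridge_loss lam c I (z(k := (?x, y))) k) \<in> borel_measurable borel"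
  proof -
    have "(\<lambda>(\<omega>, y). ridge_loss lam c I ((\<lambda>i. z i)(k := (fst (z k), y))) k) \<in> borel_measurable (borel \<Otimes>\<^sub>M borel)"
      by (rule measurable_ridge_loss_update[OF I]) simp
    from measurable_Pair2[OF this, of "0::real"] show ?thesis by simp
  qed
  have upper: "?g y \<le> normal_density (m / u) (1 / u) y / u" for y
  proof -
    have "1/2 * (u * y - m)\<^sup>2 \<le> ridge_loss lam c I (z(k := (?x, y))) k"
      using lam ridge_residual[OF I, of y z] by (simp add: ridge_loss_def u_def m_def)
    then have "?g y \<le> exp (- (1/2 * (u * y - m)\<^sup>2)) / sqrt (2 * pi)"
      by (intro divide_right_mono) auto
    also have "(u * y - m)\<^sup>2 = (y - m / u)\<^sup>2 * u\<^sup>2"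
      using u by (simp add: power_mult_distrib[symmetric] field_simps)
    also have "exp (- (1/2 * ((y - m / u)\<^sup>2 * u\<^sup>2))) / sqrt (2 * pi) = normal_density (m / u) (1 / u) y / u"
      using u by (simp add: normal_density_def real_sqrt_divide power_one_over field_simps)
    finally show ?thesis .
  qed
  have int_upper: "integrable lborel (\<lambda>y. normal_density (m / u) (1 / u) y / u)"
    using u by (intro integrable_divide integrable_normal_density) auto
  have int_g: "integrable lborel ?g"
    by (rule Bochner_Integration.integrable_bound[OF int_upper]) (use upper u in \<open>auto simp: normal_density_nonneg\<close>)
  have lower: "exp (- S) * std_normal_density y \<le> ?g y" for y
  proof -
    have "ridge_loss lam c I (z(k := (?x, y))) k \<le> (\<Sum>i\<in>I. 1/2 * (snd ((z(k := (?x, y))) i))\<^sup>2)"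
      using I lam by (intro ridge_loss_le) auto
    also have "\<dots> = S + y\<^sup>2 / 2"
      unfolding S_def using I by (subst sum.remove[of I k]) (auto intro!: sum.cong)
    finally have "exp (- S + - (y\<^sup>2 / 2)) / sqrt (2 * pi) \<le> ?g y"
      by (intro divide_right_mono) auto
    also have "exp (- S + - (y\<^sup>2 / 2)) / sqrt (2 * pi) = exp (- S) * std_normal_density y"
      unfolding exp_add by (simp add: normal_density_def)
    finally show ?thesis .
  qed
  have eq: "ridge_norm lam c I z k = (\<integral>y. ?g y \<partial>lborel)"
    unfolding ridge_norm_def by (rule integral_ref_measure) measurable
  have "exp (- S) = (\<integral>y. exp (- S) * std_normal_density y \<partial>lborel)"
    by simp
  also have "\<dots> \<le> (\<integral>y. ?g y \<partial>lborel)"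
    by (intro integral_mono int_g lower) auto
  finally show "exp (- (\<Sum>i\<in>I - {k}. 1/2 * (snd (z i))\<^sup>2)) \<le> ridge_norm lam c I z k"
    by (simp add: eq S_def)
  have "(\<integral>y. ?g y \<partial>lborel) \<le> (\<integral>y. normal_density (m / u) (1 / u) y / u \<partial>lborel)"
    by (intro integral_mono int_g int_upper upper)
  then show "ridge_norm lam c I z k \<le> 1 / (1 - leverage c I (\<lambda>i. fst (z i)) k)"
    using u by (simp add: eq u_def)
qed

lemma ln_ridge_norm_bounds:
  fixes z :: "'i \<Rightarrow> (real ^ 'd) \<times> real"
  assumes I: "finite I" "k \<in> I" and lam: "0 \<le> lam" "lam \<le> c"
  shows "- (\<Sum>i\<in>I - {k}. 1/2 * (snd (z i))\<^sup>2) \<le> ln (ridge_norm lam c I z k)"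
    and "ln (ridge_norm lam c I z k) \<le> - ln (1 - leverage c I (\<lambda>i. fst (z i)) k)"
    and "ridge_norm lam c I z k > 0"
proof -
  note b = ridge_norm_bounds[OF assms, of z]
  show pos: "ridge_norm lam c I z k > 0"
    using b(1) by (rule less_le_trans[rotated]) simp
  show "- (\<Sum>i\<in>I - {k}. 1/2 * (snd (z i))\<^sup>2) \<le> ln (ridge_norm lam c I z k)"
    using b(1) pos by (subst ln_ge_iff) auto
  have u: "1 - leverage c I (\<lambda>i. fst (z i)) k > 0"
    using leverage_less_1[OF c I] by simp
  have "ln (ridge_norm lam c I z k) \<le> ln (1 / (1 - leverage c I (\<lambda>i. fst (z i)) k))"
    using b(2) pos u by (subst ln_le_cancel_iff) auto
  then show "ln (ridge_norm lam c I z k) \<le> - ln (1 - leverage c I (\<lambda>i. fst (z i)) k)"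
    using u by (simp add: ln_div)
qed

end

section \<open>Exchangeability and coordinates of product measures\<close>

text \<open>The transposition of \<open>k\<close> and \<open>j\<close> preserves the product measure
  and, by equivariance, turns the statistic at \<open>k\<close> into the one at
  \<open>j\<close>.\<close>

lemma integral_PiM_exchangeable:
  fixes g :: "('i \<Rightarrow> 'a) \<Rightarrow> 'i \<Rightarrow> real"
  assumes P: "prob_space P" and k: "k \<in> I" "j \<in> I"
    and meas: "(\<lambda>z. g z k) \<in> borel_measurable (PiM I (\<lambda>_. P))"
    and perm: "\<And>p z. bij_betw p I I \<Longrightarrow> g (\<lambda>i\<in>I. z (p i)) k = g z (p k)"
  shows "(\<integral>z. g z k \<partial>PiM I (\<lambda>_. P)) = (\<integral>z. g z j \<partial>PiM I (\<lambda>_. P))"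
proof -
  let ?p = "Transposition.transpose k j"
  let ?Q = "PiM I (\<lambda>_. P)"
  have p: "bij_betw ?p I I"
    using k by (intro bij_betw_byWitness[where f'="?p"]) (auto simp: Transposition.transpose_def)
  have "distr ?Q ?Q (\<lambda>z. \<lambda>i\<in>I. z (?p i)) = ?Q"
    using P p by (intro distr_PiM_reindex) (auto simp: bij_betw_def)
  then have "(\<integral>z. g z k \<partial>?Q) = (\<integral>z. g z k \<partial>distr ?Q ?Q (\<lambda>z. \<lambda>i\<in>I. z (?p i)))"
    by simp
  also have "\<dots> = (\<integral>z. g (\<lambda>i\<in>I. z (?p i)) k \<partial>?Q)"
    using p by (intro integral_distr meas measurable_restrict measurable_component_singleton)
      (auto simp: bij_betw_def)
  also have "\<dots> = (\<integral>z. g z j \<partial>?Q)"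
    by (simp add: perm[OF p])
  finally show ?thesis .
qed

lemma integral_PiM_component:
  fixes f :: "'a \<Rightarrow> real"
  assumes P: "prob_space P" and i: "i \<in> I" and f: "integrable P f"
  shows "integrable (PiM I (\<lambda>_. P)) (\<lambda>z. f (z i))"
    and "(\<integral>z. f (z i) \<partial>PiM I (\<lambda>_. P)) = (\<integral>x. f x \<partial>P)"
proof -
  have d: "distr (PiM I (\<lambda>_. P)) P (\<lambda>z. z i) = P"
    using P i by (intro distr_PiM_component) auto
  have m: "(\<lambda>z. z i) \<in> PiM I (\<lambda>_. P) \<rightarrow>\<^sub>M P"
    using i by (rule measurable_component_singleton)
  show "integrable (PiM I (\<lambda>_. P)) (\<lambda>z. f (z i))"
    using integrable_distr[OF m, of f] f by (simp add: d)
  show "(\<integral>z. f (z i) \<partial>PiM I (\<lambda>_. P)) = (\<integral>x. f x \<partial>P)"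
    using integral_distr[OF m, of f] f by (simp add: d)
qed

lemma ridge_norm_cong:
  assumes "c > 0" "\<And>i. i \<in> I \<Longrightarrow> z i = z' i" "k \<in> I"
  shows "ridge_norm lam c I z k = ridge_norm lam c I z' k"
  unfolding ridge_norm_def using assms
  by (intro Bochner_Integration.integral_cong refl arg_cong[where f="\<lambda>t. exp (- t)"] ridge_loss_cong) auto

section \<open>Expected loss and expected log-normalizer over an i.i.d. sample\<close>

context
  fixes P :: "((real ^ 'd) \<times> real) measure" and I :: "'i set" and c r :: real and k :: 'i
  assumes P: "prob_space P" and sets_P: "sets P = sets borel"
    and sq: "integrable P (\<lambda>p. (norm (fst p))\<^sup>2)" "integrable P (\<lambda>p. (snd p)\<^sup>2)"
    and bound: "AE p in P. norm (fst p) \<le> r"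
    and I: "finite I" "k \<in> I" and c: "c > 0"
begin

abbreviation Q :: "('i \<Rightarrow> (real ^ 'd) \<times> real) measure" where
  "Q \<equiv> PiM I (\<lambda>_. P)"

lemma component_borel: "i \<in> I \<Longrightarrow> (\<lambda>z. z i) \<in> borel_measurable Q"
  using measurable_component_singleton[of i I "\<lambda>_. P"] by (simp add: measurable_cong_sets[OF refl sets_P])

lemma prob_space_sample: "prob_space Q"
  by (intro prob_space_PiM P)

lemma lam_bounds: "0 \<le> c / card I" "c / card I \<le> c"
proof -
  have "card I \<ge> 1"
    using I by (metis One_nat_def Suc_leI card_gt_0_iff empty_iff)
  then show "0 \<le> c / card I" "c / card I \<le> c"
    using c by (auto simp: field_simps)
qed

lemma integrable_squares: "integrable Q (\<lambda>z. \<Sum>i\<in>I. 1/2 * (snd (z i))\<^sup>2)"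
  using integral_PiM_component(1)[OF P _ sq(2)]
  by (intro Bochner_Integration.integrable_sum integrable_mult_right)

lemma measurable_sample [measurable]:
  assumes "j \<in> I"
  shows "(\<lambda>z. ridge_loss lam c I z j) \<in> borel_measurable Q"
    and "(\<lambda>z. ridge_norm lam c I z j) \<in> borel_measurable Q"
    and "(\<lambda>z. leverage c I (\<lambda>i. fst (z i)) j) \<in> borel_measurable Q"
proof -
  note * = c \<open>finite I\<close> \<open>j \<in> I\<close> component_borel
  show "(\<lambda>z. ridge_loss lam c I z j) \<in> borel_measurable Q"
    using measurable_ridge_loss[where z="\<lambda>i z. z i", OF *] by simp
  show "(\<lambda>z. ridge_norm lam c I z j) \<in> borel_measurable Q"
    using measurable_ridge_norm[where z="\<lambda>i z. z i", OF *] by simp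
  show "(\<lambda>z. leverage c I (\<lambda>i. fst (z i)) j) \<in> borel_measurable Q"
    using measurable_leverage[where z="\<lambda>i z. z i", OF *] by simp
qed

lemma integrable_ridge_loss:
  assumes "j \<in> I"
  shows "integrable Q (\<lambda>z. ridge_loss (c / card I) c I z j)"
proof (rule Bochner_Integration.integrable_bound[OF integrable_squares measurable_sample(1)[OF assms]])
  have "norm (ridge_loss (c / card I) c I z j) \<le> norm (\<Sum>i\<in>I. 1/2 * (snd (z i))\<^sup>2)"
    for z :: "'i \<Rightarrow> (real ^ 'd) \<times> real"
    using ridge_loss_nonneg[OF c lam_bounds(1), of I z j]
      ridge_loss_le[OF c \<open>finite I\<close> assms lam_bounds(2), of z] by simp
  then show "AE z in Q. norm (ridge_loss (c / card I) c I z j) \<le> norm (\<Sum>i\<in>I. 1/2 * (snd (z i))\<^sup>2)"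
    by simp
qed

lemma integrable_square_loss: "integrable P (\<lambda>p. 1/2 * (snd p - \<theta> \<bullet> fst p)\<^sup>2)"
proof (rule Bochner_Integration.integrable_bound)
  show "integrable P (\<lambda>p. (snd p)\<^sup>2 + (norm \<theta>)\<^sup>2 * (norm (fst p))\<^sup>2)"
    using sq by (intro Bochner_Integration.integrable_add integrable_mult_right)
  have [measurable]: "fst \<in> borel_measurable P" "snd \<in> borel_measurable P"
    using borel_measurable_fst_snd[of "\<lambda>p. p" P] by (simp_all add: measurable_ident_sets sets_P)
  show "(\<lambda>p. 1/2 * (snd p - \<theta> \<bullet> fst p)\<^sup>2) \<in> borel_measurable P"
    by measurable
  have "1/2 * (snd p - \<theta> \<bullet> fst p)\<^sup>2 \<le> (snd p)\<^sup>2 + (norm \<theta>)\<^sup>2 * (norm (fst p))\<^sup>2" for p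
  proof -
    have "(\<theta> \<bullet> fst p)\<^sup>2 \<le> (norm \<theta> * norm (fst p))\<^sup>2"
      using Cauchy_Schwarz_ineq2[of \<theta> "fst p"] by (intro power2_le_iff_abs_le[THEN iffD2]) auto
    \<comment> \<open>This rearranges \<open>(a + b)^2 >= 0\<close> for \<open>a = snd p\<close> and
      \<open>b = \<theta> \<bullet> fst p\<close>.\<close>
    moreover have "1/2 * (snd p - \<theta> \<bullet> fst p)\<^sup>2 \<le> (snd p)\<^sup>2 + (\<theta> \<bullet> fst p)\<^sup>2"
      using zero_le_power2[of "snd p + \<theta> \<bullet> fst p"] by (simp add: power2_eq_square algebra_simps)
    ultimately show ?thesis
      by (simp add: power_mult_distrib)
  qed
  then show "AE p in P. norm (1/2 * (snd p - \<theta> \<bullet> fst p)\<^sup>2) \<le> norm ((snd p)\<^sup>2 + (norm \<theta>)\<^sup>2 * (norm (fst p))\<^sup>2)"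
    by (simp add: abs_mult)
qed

text \<open>By exchangeability, \<open>card I\<close> times the left side is the expectation of the
  sum of all losses, which is the minimal objective. Comparing it pointwise with the objective at
  the fixed \<open>\<theta>\<close> decouples the estimator from the data.\<close>

lemma expected_ridge_loss_le:
  "(\<integral>z. ridge_loss (c / card I) c I z k \<partial>Q) \<le> (\<integral>p. 1/2 * (snd p - \<theta> \<bullet> fst p)\<^sup>2 \<partial>P) + c / card I / 2 * (norm \<theta>)\<^sup>2"
proof -
  interpret Q: prob_space Q
    by (rule prob_space_sample)
  have ne: "I \<noteq> {}" "card I > 0"
    using I by (auto simp: card_gt_0_iff)
  have "card I * (\<integral>z. ridge_loss (c / card I) c I z k \<partial>Q) = (\<Sum>j\<in>I. \<integral>z. ridge_loss (c / card I) c I z k \<partial>Q)"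
    by simp
  also have "\<dots> = (\<Sum>j\<in>I. \<integral>z. ridge_loss (c / card I) c I z j \<partial>Q)"
  proof (intro sum.cong refl integral_PiM_exchangeable P I measurable_sample)
    fix p z assume p: "bij_betw p I I"
    have "ridge_loss (c / card I) c I (\<lambda>i\<in>I. z (p i)) k = ridge_loss (c / card I) c I (\<lambda>i. z (p i)) k"
      using I by (intro ridge_loss_cong[OF c]) auto
    then show "ridge_loss (c / card I) c I (\<lambda>i\<in>I. z (p i)) k = ridge_loss (c / card I) c I z (p k)"
      by (simp add: ridge_loss_reindex[OF c p])
  qed
  also have "\<dots> = (\<integral>z. (\<Sum>j\<in>I. ridge_loss (c / card I) c I z j) \<partial>Q)"
    by (intro Bochner_Integration.integral_sum[symmetric] integrable_ridge_loss)
  also have "\<dots> \<le> (\<integral>z. ridge_obj c I z \<theta> \<partial>Q)"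
  proof (rule integral_mono)
    show "integrable Q (\<lambda>z. \<Sum>j\<in>I. ridge_loss (c / card I) c I z j)"
      by (intro Bochner_Integration.integrable_sum integrable_ridge_loss)
    show "integrable Q (\<lambda>z. ridge_obj c I z \<theta>)"
      unfolding ridge_obj_def
      by (intro Bochner_Integration.integrable_add Bochner_Integration.integrable_sum
          integral_PiM_component(1)[OF P _ integrable_square_loss] Q.integrable_const)
    show "(\<Sum>j\<in>I. ridge_loss (c / card I) c I z j) \<le> ridge_obj c I z \<theta>" for z
      using ridge_obj_min[OF c, of I z \<theta>] sum_ridge_loss[OF c \<open>finite I\<close> ne(1), of z] by simp
  qed
  also have "\<dots> = (\<integral>z. (\<Sum>i\<in>I. 1/2 * (snd (z i) - \<theta> \<bullet> fst (z i))\<^sup>2) \<partial>Q) + (\<integral>z. c / 2 * (norm \<theta>)\<^sup>2 \<partial>Q)"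
    unfolding ridge_obj_def
    by (intro Bochner_Integration.integral_add Bochner_Integration.integrable_sum
        integral_PiM_component(1)[OF P _ integrable_square_loss] Q.integrable_const)
  also have "(\<integral>z. (\<Sum>i\<in>I. 1/2 * (snd (z i) - \<theta> \<bullet> fst (z i))\<^sup>2) \<partial>Q)
      = (\<Sum>i\<in>I. \<integral>z. 1/2 * (snd (z i) - \<theta> \<bullet> fst (z i))\<^sup>2 \<partial>Q)"
    by (intro Bochner_Integration.integral_sum integral_PiM_component(1)[OF P _ integrable_square_loss])
  also have "\<dots> = (\<Sum>i\<in>I. \<integral>p. 1/2 * (snd p - \<theta> \<bullet> fst p)\<^sup>2 \<partial>P)"
    by (intro sum.cong refl integral_PiM_component(2)[OF P _ integrable_square_loss])
  also have "(\<integral>z. c / 2 * (norm \<theta>)\<^sup>2 \<partial>Q) = c / 2 * (norm \<theta>)\<^sup>2"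
    by (simp add: Q.prob_space)
  finally show ?thesis
    using ne(2) by (simp add: field_simps)
qed

text \<open>Leverages lie between 0 and 1, hence are integrable. All of them have the same mean by
  exchangeability, and \<open>sum_leverage_le\<close> bounds their sum.\<close>

lemma expected_leverage_le: "(\<integral>z. leverage c I (\<lambda>i. fst (z i)) k \<partial>Q) \<le> CARD('d) / card I"
  and integrable_leverage: "integrable Q (\<lambda>z. leverage c I (\<lambda>i. fst (z i)) k)"
proof -
  interpret Q: prob_space Q
    by (rule prob_space_sample)
  have ne: "card I > 0"
    using I by (auto simp: card_gt_0_iff)
  have int: "integrable Q (\<lambda>z. leverage c I (\<lambda>i. fst (z i)) j)" if "j \<in> I" for j
  proof (rule Q.integrable_const_bound[where B=1])
    have "norm (leverage c I (\<lambda>i. fst (z i)) j) \<le> 1" for z :: "'i \<Rightarrow> (real ^ 'd) \<times> real"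
      using leverage_nonneg[OF c, of I "\<lambda>i. fst (z i)" j]
        leverage_less_1[OF c \<open>finite I\<close> that, of "\<lambda>i. fst (z i)"] by simp
    then show "AE z in Q. norm (leverage c I (\<lambda>i. fst (z i)) j) \<le> 1"
      by simp
  qed (rule measurable_sample(3)[OF that])
  show "integrable Q (\<lambda>z. leverage c I (\<lambda>i. fst (z i)) k)"
    using int I by simp
  have "card I * (\<integral>z. leverage c I (\<lambda>i. fst (z i)) k \<partial>Q) = (\<Sum>j\<in>I. \<integral>z. leverage c I (\<lambda>i. fst (z i)) k \<partial>Q)"
    by simp
  also have "\<dots> = (\<Sum>j\<in>I. \<integral>z. leverage c I (\<lambda>i. fst (z i)) j \<partial>Q)"
  proof (intro sum.cong refl integral_PiM_exchangeable P I measurable_sample)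
    fix p and z :: "'i \<Rightarrow> (real ^ 'd) \<times> real" assume p: "bij_betw p I I"
    have "leverage c I (\<lambda>i. fst ((\<lambda>i\<in>I. z (p i)) i)) k = leverage c I (\<lambda>i. fst (z (p i))) k"
      unfolding leverage_def using I
      by (subst ridge_inv_cong[where x'="\<lambda>i. fst (z (p i))"]) auto
    then show "leverage c I (\<lambda>i. fst ((\<lambda>i\<in>I. z (p i)) i)) k = leverage c I (\<lambda>i. fst (z i)) (p k)"
      using leverage_reindex[OF p, of c "\<lambda>i. fst (z i)" k] by simp
  qed
  also have "\<dots> = (\<integral>z. (\<Sum>j\<in>I. leverage c I (\<lambda>i. fst (z i)) j) \<partial>Q)"
    by (intro Bochner_Integration.integral_sum[symmetric] int)
  also have "\<dots> \<le> (\<integral>z. CARD('d) \<partial>Q)"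
    using sum_leverage_le[OF c, where 'b="real ^ 'd"]
    by (intro integral_mono Bochner_Integration.integrable_sum int Q.integrable_const) simp_all
  finally show "(\<integral>z. leverage c I (\<lambda>i. fst (z i)) k \<partial>Q) \<le> CARD('d) / card I"
    using ne by (simp add: Q.prob_space field_simps)
qed

lemma AE_bound: "AE z in Q. norm (fst (z k)) \<le> r"
  using P I bound by (intro AE_PiM_component) auto

text \<open>The logarithm is bounded below by minus half the sum of squared labels and, almost
  surely, above by \<open>ln (1 + r^2 / c)\<close>. The sum of the two nonnegative bounds dominates
  its absolute value.\<close>

lemma integrable_ln_ridge_norm: "integrable Q (\<lambda>z. ln (ridge_norm (c / card I) c I z k))"
proof (rule Bochner_Integration.integrable_bound)
  interpret Q: prob_space Q
    by (rule prob_space_sample)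
  show "integrable Q (\<lambda>z. (\<Sum>i\<in>I. 1/2 * (snd (z i))\<^sup>2) + ln (1 + r\<^sup>2 / c))"
    by (intro Bochner_Integration.integrable_add integrable_squares Q.integrable_const)
  show "(\<lambda>z. ln (ridge_norm (c / card I) c I z k)) \<in> borel_measurable Q"
    using measurable_sample(2)[OF I(2)] by measurable
  show "AE z in Q. norm (ln (ridge_norm (c / card I) c I z k))
      \<le> norm ((\<Sum>i\<in>I. 1/2 * (snd (z i))\<^sup>2) + ln (1 + r\<^sup>2 / c))"
    using AE_bound
  proof eventually_elim
    fix z :: "'i \<Rightarrow> (real ^ 'd) \<times> real" assume "norm (fst (z k)) \<le> r"
    then have "- ln (1 - leverage c I (\<lambda>i. fst (z i)) k) \<le> ln (1 + r\<^sup>2 / c)"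
      using I by (intro ln_leverage_le[OF c]) auto
    moreover have "(\<Sum>i\<in>I - {k}. 1/2 * (snd (z i))\<^sup>2) \<le> (\<Sum>i\<in>I. 1/2 * (snd (z i))\<^sup>2)"
      using I by (intro sum_mono2) auto
    moreover have "0 \<le> (\<Sum>i\<in>I. 1/2 * (snd (z i))\<^sup>2)"
      by (intro sum_nonneg) auto
    moreover have "0 \<le> ln (1 + r\<^sup>2 / c)"
      using c by simp
    moreover note ln_ridge_norm_bounds(1,2)[OF c I lam_bounds, of z]
    ultimately show "norm (ln (ridge_norm (c / card I) c I z k))
        \<le> norm ((\<Sum>i\<in>I. 1/2 * (snd (z i))\<^sup>2) + ln (1 + r\<^sup>2 / c))"
      unfolding real_norm_def by linarith
  qed
qed

lemma expected_ln_ridge_norm_le: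
  "(\<integral>z. ln (ridge_norm (c / card I) c I z k) \<partial>Q) \<le> CARD('d) / card I * (1 + ln (1 + r\<^sup>2 / c))"
proof -
  have "(\<integral>z. ln (ridge_norm (c / card I) c I z k) \<partial>Q)
      \<le> (\<integral>z. leverage c I (\<lambda>i. fst (z i)) k * (1 + ln (1 + r\<^sup>2 / c)) \<partial>Q)"
  proof (rule integral_mono_AE)
    show "AE z in Q. ln (ridge_norm (c / card I) c I z k)
        \<le> leverage c I (\<lambda>i. fst (z i)) k * (1 + ln (1 + r\<^sup>2 / c))"
      using AE_bound
    proof eventually_elim
      fix z :: "'i \<Rightarrow> (real ^ 'd) \<times> real" assume "norm (fst (z k)) \<le> r"
      then have "- ln (1 - leverage c I (\<lambda>i. fst (z i)) k)
          \<le> leverage c I (\<lambda>i. fst (z i)) k * (1 + ln (1 + r\<^sup>2 / c))"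
        using I by (intro ln_leverage_le_linear[OF c]) auto
      then show "ln (ridge_norm (c / card I) c I z k)
          \<le> leverage c I (\<lambda>i. fst (z i)) k * (1 + ln (1 + r\<^sup>2 / c))"
        using ln_ridge_norm_bounds(2)[OF c I lam_bounds, of z] by linarith
    qed
  qed (intro integrable_ln_ridge_norm integrable_mult_left integrable_leverage)+
  also have "\<dots> = (\<integral>z. leverage c I (\<lambda>i. fst (z i)) k \<partial>Q) * (1 + ln (1 + r\<^sup>2 / c))"
    by (intro integral_mult_left_zero)
  also have "\<dots> \<le> CARD('d) / card I * (1 + ln (1 + r\<^sup>2 / c))"
    using c by (intro mult_right_mono expected_leverage_le add_nonneg_nonneg) auto
  finally show ?thesis .
qed

end

section \<open>The predictor and the resampled test point\<close>

text \<open>The predictor reads its sample at the indices 1 to \<open>n\<close> only, so index 0 is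
  free to hold the test point, and \<open>{0..n}\<close> carries the full sample of size
  \<open>n + 1\<close>.\<close>

lemma smp_eq_ridge_loss:
  fixes z :: "nat \<Rightarrow> (real ^ 'd) \<times> real"
  assumes c: "c > 0" "c = (real n + 1) * lam" and lam: "0 \<le> lam" "lam \<le> c"
  shows "- ln (smp lam n (\<lambda>i. fst (z i)) (\<lambda>i. snd (z i)) (fst p) (snd p)) =
    ridge_loss lam c {0..n} (z(0 := p)) 0 + ln (ridge_norm lam c {0..n} (z(0 := p)) 0)"
proof -
  let ?z = "\<lambda>y. z(0 := (fst p, y))"
  have "{0..n} = insert 0 {1..n}"
    by auto
  then have "ridge_obj c {0..n} (?z y) \<theta> = (\<Sum>i=1..n. 1/2 * (snd (z i) - \<theta> \<bullet> fst (z i))\<^sup>2)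
      + 1/2 * (y - \<theta> \<bullet> fst p)\<^sup>2 + (real n + 1) * (lam / 2) * (norm \<theta>)\<^sup>2" for y \<theta>
    by (simp add: ridge_obj_def c(2))
  then have "ridge_est lam n (\<lambda>i. fst (z i)) (\<lambda>i. snd (z i)) (fst p) y = ridge c {0..n} (?z y)" for y
    unfolding ridge_est_def arg_min_ridge_obj[OF c(1), symmetric] by presburger
  then have eq: "smp_unnormalized lam n (\<lambda>i. fst (z i)) (\<lambda>i. snd (z i)) (fst p) y =
      exp (- ridge_loss lam c {0..n} (?z y) 0)" for y
    by (simp add: smp_unnormalized_def gauss_lin_def ridge_loss_def flip: exp_add)
  \<comment> \<open>Positivity lets the logarithm of the quotient in \<open>smp\<close>
    split.\<close>
  have "ridge_norm lam c {0..n} (z(0 := p)) 0 > 0"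
    by (rule ln_ridge_norm_bounds(3)[OF c(1) _ _ lam]) auto
  then show ?thesis
    unfolding smp_def eq by (simp add: ridge_norm_def ln_div)
qed

text \<open>The sample and the test point live on the same space \<open>M\<close>; the inner
  integral over \<open>\<omega>'\<close> draws a fresh copy of \<open>Z k\<close> to overwrite
  coordinate \<open>k\<close>. Such an overwriting preserves the product measure, so Fubini turns
  the iterated integral into one over the product.\<close>

lemma iid_resample:
  fixes Z :: "'i \<Rightarrow> 'a \<Rightarrow> 'b" and F :: "('i \<Rightarrow> 'b) \<Rightarrow> real"
  assumes M: "prob_space M" and Z: "\<And>i. i \<in> I \<Longrightarrow> Z i \<in> M \<rightarrow>\<^sub>M P" and P: "distr M P (Z k) = P" and k: "k \<in> I"
    and distr_Z: "distr M (PiM I (\<lambda>_. P)) (\<lambda>\<omega>. \<lambda>i\<in>I. Z i \<omega>) = PiM I (\<lambda>_. P)"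
    and F: "integrable (PiM I (\<lambda>_. P)) F"
  shows "AE \<omega> in M. integrable M (\<lambda>\<omega>'. F ((\<lambda>i\<in>I. Z i \<omega>)(k := Z k \<omega>')))"
    and "integrable M (\<lambda>\<omega>. \<integral>\<omega>'. F ((\<lambda>i\<in>I. Z i \<omega>)(k := Z k \<omega>')) \<partial>M)"
    and "(\<integral>\<omega>. \<integral>\<omega>'. F ((\<lambda>i\<in>I. Z i \<omega>)(k := Z k \<omega>')) \<partial>M \<partial>M) = (\<integral>z. F z \<partial>PiM I (\<lambda>_. P))"
proof -
  let ?Q = "PiM I (\<lambda>_. P)"
  let ?S = "\<lambda>\<omega>. \<lambda>i\<in>I. Z i \<omega>"
  interpret P: prob_space P
    using prob_space.prob_space_distr[OF M Z[OF k]] P by simp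
  interpret Q: prob_space ?Q
    by (intro prob_space_PiM P.prob_space_axioms)
  interpret PQ: pair_sigma_finite P ?Q ..
  have S: "?S \<in> M \<rightarrow>\<^sub>M ?Q"
    by (intro measurable_restrict Z)
  \<comment> \<open>The library facts adjoin a new coordinate to \<open>I\<close>. As
    \<open>k\<close> already lies in \<open>I\<close>, \<open>insert k I = I\<close> and the map
    overwrites instead.\<close>
  have upd: "(\<lambda>(p, z). z(k := p)) \<in> P \<Otimes>\<^sub>M ?Q \<rightarrow>\<^sub>M ?Q"
    using measurable_compose[OF measurable_pair_swap' measurable_add_dim[of k I "\<lambda>_. P"]] k
    by (simp add: insert_absorb case_prod_beta')
  have distr_upd: "distr (P \<Otimes>\<^sub>M ?Q) ?Q (\<lambda>(p, z). z(k := p)) = ?Q"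
    using distr_pair_PiM_eq_PiM[of I "\<lambda>_. P" k] P.prob_space_axioms k by (simp add: insert_absorb)
  have int: "integrable (P \<Otimes>\<^sub>M ?Q) (\<lambda>(p, z). F (z(k := p)))"
    using integrable_distr[OF upd, of F, unfolded distr_upd, OF F] by (simp add: case_prod_beta')
  have inner: "integrable M (\<lambda>\<omega>'. F (z(k := Z k \<omega>'))) \<longleftrightarrow> integrable P (\<lambda>p. F (z(k := p)))"
    "(\<integral>\<omega>'. F (z(k := Z k \<omega>')) \<partial>M) = (\<integral>p. F (z(k := p)) \<partial>P)" if "z \<in> space ?Q" for z
  proof -
    have "(\<lambda>p. F (z(k := p))) \<in> borel_measurable P"
      using measurable_compose[OF measurable_Pair2'[OF that, of P], of "\<lambda>(p, z). F (z(k := p))"]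
        borel_measurable_integrable[OF int] by simp
    then show "integrable M (\<lambda>\<omega>'. F (z(k := Z k \<omega>'))) \<longleftrightarrow> integrable P (\<lambda>p. F (z(k := p)))"
      "(\<integral>\<omega>'. F (z(k := Z k \<omega>')) \<partial>M) = (\<integral>p. F (z(k := p)) \<partial>P)"
      using integrable_distr_eq[OF Z[OF k], of "\<lambda>p. F (z(k := p))"]
        integral_distr[OF Z[OF k], of "\<lambda>p. F (z(k := p))"] by (simp_all add: P)
  qed
  \<comment> \<open>Fubini gives integrable sections only almost everywhere; this is pulled back to
    \<open>M\<close> along the sample map.\<close>
  have "AE z in ?Q. integrable P (\<lambda>p. F (z(k := p)))"
    using PQ.AE_integrable_snd[OF int] .
  then have "AE \<omega> in M. integrable P (\<lambda>p. F ((?S \<omega>)(k := p)))"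
    by (subst (asm) distr_Z[symmetric]) (rule AE_distrD[OF S])
  then show "AE \<omega> in M. integrable M (\<lambda>\<omega>'. F ((?S \<omega>)(k := Z k \<omega>')))"
    by (rule AE_mp) (use measurable_space[OF S] in \<open>auto simp: inner intro!: AE_I2\<close>)
  have outer: "(\<integral>\<omega>'. F ((?S \<omega>)(k := Z k \<omega>')) \<partial>M) = (\<integral>p. F ((?S \<omega>)(k := p)) \<partial>P)" if "\<omega> \<in> space M" for \<omega>
    by (rule inner(2)[OF measurable_space[OF S that]])
  have int_outer: "integrable ?Q (\<lambda>z. \<integral>p. F (z(k := p)) \<partial>P)"
    by (rule PQ.integrable_snd[OF int])
  have "integrable M (\<lambda>\<omega>. \<integral>p. F ((?S \<omega>)(k := p)) \<partial>P)"
    using integrable_distr[OF S, of "\<lambda>z. \<integral>p. F (z(k := p)) \<partial>P"] int_outer by (simp add: distr_Z)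
  then show "integrable M (\<lambda>\<omega>. \<integral>\<omega>'. F ((?S \<omega>)(k := Z k \<omega>')) \<partial>M)"
    using outer by (subst Bochner_Integration.integrable_cong[OF refl]) auto
  have "(\<integral>\<omega>. \<integral>\<omega>'. F ((?S \<omega>)(k := Z k \<omega>')) \<partial>M \<partial>M) = (\<integral>\<omega>. \<integral>p. F ((?S \<omega>)(k := p)) \<partial>P \<partial>M)"
    using outer by (intro Bochner_Integration.integral_cong) auto
  also have "\<dots> = (\<integral>z. \<integral>p. F (z(k := p)) \<partial>P \<partial>?Q)"
    using integral_distr[OF S, of "\<lambda>z. \<integral>p. F (z(k := p)) \<partial>P"] borel_measurable_integrable[OF int_outer]
    by (simp add: distr_Z)
  also have "\<dots> = (\<integral>(p, z). F (z(k := p)) \<partial>(P \<Otimes>\<^sub>M ?Q))"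
    by (rule PQ.integral_snd[OF int])
  also have "\<dots> = (\<integral>z. F z \<partial>?Q)"
    using integral_distr[OF upd, of F, unfolded distr_upd] F by (simp add: case_prod_beta')
  finally show "(\<integral>\<omega>. \<integral>\<omega>'. F ((?S \<omega>)(k := Z k \<omega>')) \<partial>M \<partial>M) = (\<integral>z. F z \<partial>?Q)" .
qed

section \<open>Constants and the risk bound\<close>

text \<open>Two of the five logarithms come from \<open>1 + t^2 <= (2 + t)^2\<close>; the other
  three absorb \<open>3/2\<close>, because \<open>ln (2 + t) >= ln 2 >= 1/2\<close>.\<close>

lemma log_bound:
  assumes "t \<ge> (0::real)"
  shows "3/2 + ln (1 + t\<^sup>2) \<le> 5 * ln (2 + t)"
proof -
  have "1 + t\<^sup>2 \<le> (2 + t)\<^sup>2"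
    using assms by (simp add: power2_eq_square algebra_simps)
  then have "ln (1 + t\<^sup>2) \<le> ln ((2 + t)\<^sup>2)"
    by (intro ln_mono add_pos_nonneg) auto
  moreover have "ln ((2 + t)\<^sup>2) = 2 * ln (2 + t)"
    using assms by (simp add: ln_realpow)
  moreover have "ln 2 \<le> ln (2 + t)"
    using assms by simp
  moreover have "(1/2 :: real) \<le> ln 2"
    using ln_le_minus_one[of "1/2 :: real"] by (simp add: ln_div)
  ultimately show ?thesis
    by linarith
qed

theorem proposition3:
  fixes M :: "'a measure"
    and X :: "nat \<Rightarrow> 'a \<Rightarrow> real ^ 'd"
    and Y :: "nat \<Rightarrow> 'a \<Rightarrow> real"
    and n :: nat
    and B R lam :: real
  assumes "prob_space M"
    and "prob_space.indep_vars M (\<lambda>_. borel) (\<lambda>i \<omega>. (X i \<omega>, Y i \<omega>)) {0..n}"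
    and "\<And>i. i \<in> {0..n} \<Longrightarrow>
           distr M borel (\<lambda>\<omega>. (X i \<omega>, Y i \<omega>)) = distr M borel (\<lambda>\<omega>. (X 0 \<omega>, Y 0 \<omega>))"
    and "integrable M (\<lambda>\<omega>. (norm (X 0 \<omega>))\<^sup>2)"
    and "integrable M (\<lambda>\<omega>. (Y 0 \<omega>)\<^sup>2)"
    and "R > 0"
    and "AE \<omega> in M. norm (X 0 \<omega>) \<le> R"
    and "B > 0"
    and "lam = real CARD('d) / (B\<^sup>2 * (real n + 1))"
  shows "(AE \<omega> in M. integrable M
            (\<lambda>\<omega>'. - ln (smp lam n (\<lambda>i. X i \<omega>) (\<lambda>i. Y i \<omega>) (X 0 \<omega>') (Y 0 \<omega>'))))
       \<and> integrable M (\<lambda>\<omega>. risk M (X 0) (Y 0) (smp lam n (\<lambda>i. X i \<omega>) (\<lambda>i. Y i \<omega>)))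
       \<and> (\<integral>\<omega>. risk M (X 0) (Y 0) (smp lam n (\<lambda>i. X i \<omega>) (\<lambda>i. Y i \<omega>)) \<partial>M)
           - (INF \<theta>\<in>{\<theta> :: real ^ 'd. norm \<theta> \<le> B}. risk M (X 0) (Y 0) (gauss_lin \<theta>))
         \<le> 5 * real CARD('d) * ln (2 + B * R / sqrt (real CARD('d))) / (real n + 1)"
proof -
  interpret prob_space M
    by (rule assms(1))
  define d where "d = real CARD('d)"
  \<comment> \<open>The total penalty \<open>(n + 1) * lam\<close>; the prescribed
    \<open>lam\<close> makes it independent of \<open>n\<close>.\<close>
  define c where "c = d / B\<^sup>2"
  define Z where "Z i \<omega> = (X i \<omega>, Y i \<omega>)" for i \<omega>
  define P where "P = distr M borel (Z 0)"
  define Q where "Q = PiM {0..n} (\<lambda>_. P)"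
  define F where "F z = ridge_loss lam c {0..n} z 0 + ln (ridge_norm lam c {0..n} z 0)"
    for z :: "nat \<Rightarrow> (real ^ 'd) \<times> real"
  have d: "d \<ge> 1" "d > 0"
    unfolding d_def by (simp_all add: Suc_leI)
  have c: "c > 0" "c = (real n + 1) * lam" "lam = c / card {0..n}"
    using d \<open>B > 0\<close> by (simp_all add: c_def assms(9) add.commute flip: d_def)
  have Z [measurable]: "Z i \<in> borel_measurable M" if "i \<in> {0..n}" for i
    using assms(2) that unfolding indep_vars_def Z_def by auto
  have sets_P [measurable_cong]: "sets P = sets borel"
    by (simp add: P_def)
  have P: "prob_space P"
    unfolding P_def by (intro prob_space_distr Z) simp
  have fst_snd [measurable]: "fst \<in> borel_measurable (borel :: ((real ^ 'd) \<times> real) measure)"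
    "snd \<in> borel_measurable (borel :: ((real ^ 'd) \<times> real) measure)"
    using borel_measurable_fst_snd[of "\<lambda>p. p" borel] by simp_all
  have sq: "integrable P (\<lambda>p. (norm (fst p))\<^sup>2)" "integrable P (\<lambda>p. (snd p)\<^sup>2)"
    unfolding P_def using assms(4,5) Z by (simp_all add: integrable_distr_eq Z_def)
  have bound: "AE p in P. norm (fst p) \<le> R"
    unfolding P_def using assms(7) Z by (subst AE_distr_iff) (auto simp: Z_def)
  have zero: "0 \<in> {0..n}"
    by simp
  have F: "integrable Q F"
    unfolding F_def Q_def c(3)
    by (intro Bochner_Integration.integrable_add integrable_ridge_loss[OF P sets_P sq bound _ zero c(1)]
        integrable_ln_ridge_norm[OF P sets_P sq bound _ zero c(1)]) auto
  have indep: "indep_vars (\<lambda>_. borel) Z {0..n}"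
    using assms(2) by (simp only: Z_def[abs_def])
  \<comment> \<open>\<open>P\<close> and \<open>borel\<close> have the same measurable sets, so
    independence, which is stated over \<open>borel\<close>, together with equal marginals
    identifies the law of the sample with the product of \<open>P\<close>.\<close>
  have "distr M (PiM {0..n} (\<lambda>_. P)) (\<lambda>\<omega>. \<lambda>i\<in>{0..n}. Z i \<omega>)
      = distr M (PiM {0..n} (\<lambda>_. borel)) (\<lambda>\<omega>. \<lambda>i\<in>{0..n}. Z i \<omega>)"
    by (intro distr_cong sets_PiM_cong refl) (simp add: sets_P)
  also have "\<dots> = PiM {0..n} (\<lambda>i. distr M borel (Z i))"
    by (rule indep_vars_iff_distr_eq_PiM'[THEN iffD1, OF _ _ indep]) (auto intro: Z)
  also have "\<dots> = PiM {0..n} (\<lambda>_. P)"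
    unfolding P_def Z_def[abs_def] by (rule PiM_cong[OF refl assms(3)])
  finally have distr_Z: "distr M (PiM {0..n} (\<lambda>_. P)) (\<lambda>\<omega>. \<lambda>i\<in>{0..n}. Z i \<omega>) = PiM {0..n} (\<lambda>_. P)" .
  note resample = iid_resample[OF assms(1) _ _ zero distr_Z, folded Q_def, OF _ _ F]
  \<comment> \<open>Coordinate 0 of the sample is overwritten by the test point, and restricting to
    \<open>{0..n}\<close> is harmless because \<open>F\<close> sees only these coordinates.\<close>
  have loss: "- ln (smp lam n (\<lambda>i. X i \<omega>) (\<lambda>i. Y i \<omega>) (X 0 \<omega>') (Y 0 \<omega>'))
      = F ((\<lambda>i\<in>{0..n}. Z i \<omega>)(0 := Z 0 \<omega>'))" for \<omega> \<omega>'
  proof -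
    have "- ln (smp lam n (\<lambda>i. X i \<omega>) (\<lambda>i. Y i \<omega>) (X 0 \<omega>') (Y 0 \<omega>')) = F ((\<lambda>i. Z i \<omega>)(0 := Z 0 \<omega>'))"
      using smp_eq_ridge_loss[OF c(1,2), of "\<lambda>i. Z i \<omega>" "Z 0 \<omega>'"] lam_bounds[OF P sets_P sq bound _ zero c(1)]
      by (simp add: F_def Z_def c(3))
    also have "\<dots> = F ((\<lambda>i\<in>{0..n}. Z i \<omega>)(0 := Z 0 \<omega>'))"
      unfolding F_def
      by (intro arg_cong2[where f="(+)"] arg_cong[where f=ln] ridge_loss_cong ridge_norm_cong c(1)) auto
    finally show ?thesis .
  qed
  have risk_loss: "risk M (X 0) (Y 0) (smp lam n (\<lambda>i. X i \<omega>) (\<lambda>i. Y i \<omega>))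
      = (\<integral>\<omega>'. F ((\<lambda>i\<in>{0..n}. Z i \<omega>)(0 := Z 0 \<omega>')) \<partial>M)" for \<omega>
    unfolding risk_def loss ..
  have ZP: "\<And>i. i \<in> {0..n} \<Longrightarrow> Z i \<in> M \<rightarrow>\<^sub>M P" "distr M P (Z 0) = P"
    by (auto simp: P_def intro: Z distr_cong)
  note resample = resample[OF ZP]
  \<comment> \<open>Of the \<open>3/2\<close>, the share \<open>1/2\<close> pays for the penalty,
    since \<open>lam / 2 * B^2 = d / (2 * (n + 1))\<close>. The rest,
    \<open>1 + ln (1 + R^2 / c)\<close>, comes from the normalizer.\<close>
  define K where "K = d / (real n + 1) * (3/2 + ln (1 + R\<^sup>2 / c))"
  have K_eq: "K = d / (real n + 1) * (1/2) + d / (real n + 1) * (1 + ln (1 + R\<^sup>2 / c))"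
    unfolding K_def by (subst distrib_left[symmetric]) simp
  have risk_le: "(\<integral>z. F z \<partial>Q) \<le> risk M (X 0) (Y 0) (gauss_lin \<theta>) + K" if "norm \<theta> \<le> B" for \<theta> :: "real ^ 'd"
  proof -
    have "(\<integral>z. F z \<partial>Q) = (\<integral>z. ridge_loss lam c {0..n} z 0 \<partial>Q) + (\<integral>z. ln (ridge_norm lam c {0..n} z 0) \<partial>Q)"
      unfolding F_def Q_def c(3)
      by (intro Bochner_Integration.integral_add integrable_ridge_loss[OF P sets_P sq bound _ zero c(1)]
        integrable_ln_ridge_norm[OF P sets_P sq bound _ zero c(1)]) auto
    also have "\<dots> \<le> ((\<integral>p. 1/2 * (snd p - \<theta> \<bullet> fst p)\<^sup>2 \<partial>P) + lam / 2 * (norm \<theta>)\<^sup>2)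
        + CARD('d) / card {0..n} * (1 + ln (1 + R\<^sup>2 / c))"
      unfolding Q_def c(3)
      by (intro add_mono expected_ridge_loss_le[OF P sets_P sq bound _ zero c(1)]
        expected_ln_ridge_norm_le[OF P sets_P sq bound _ zero c(1)]) auto
    also have "(\<integral>p. 1/2 * (snd p - \<theta> \<bullet> fst p)\<^sup>2 \<partial>P) = risk M (X 0) (Y 0) (gauss_lin \<theta>)"
    proof -
      have "(\<lambda>p. 1/2 * (snd p - \<theta> \<bullet> fst p)\<^sup>2) \<in> borel_measurable borel"
        by measurable
      from integral_distr[OF Z[OF zero] this] show ?thesis
        by (simp add: P_def risk_def gauss_lin_def Z_def)
    qed
    also have "lam / 2 * (norm \<theta>)\<^sup>2 \<le> lam / 2 * B\<^sup>2"
      using that by (intro mult_left_mono power_mono) (auto simp: assms(9))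
    also have "lam / 2 * B\<^sup>2 = d / (real n + 1) * (1/2)"
      using \<open>B > 0\<close> by (simp add: assms(9) d_def)
    also have "CARD('d) / card {0..n} = d / (real n + 1)"
      by (simp add: d_def add.commute)
    finally show ?thesis
      by (simp only: K_eq add.assoc)
  qed
  \<comment> \<open>\<open>K\<close> does not depend on \<open>\<theta>\<close>, so the bound passes
    to the infimum over the ball, which contains 0.\<close>
  have "(\<integral>z. F z \<partial>Q) - K \<le> (INF \<theta>\<in>{\<theta> :: real ^ 'd. norm \<theta> \<le> B}. risk M (X 0) (Y 0) (gauss_lin \<theta>))"
  proof (rule cINF_greatest)
    show "{\<theta> :: real ^ 'd. norm \<theta> \<le> B} \<noteq> {}"
      using \<open>B > 0\<close> by (auto intro!: exI[of _ 0])
  qed (use risk_le in \<open>auto simp: algebra_simps\<close>)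
  moreover have "K \<le> 5 * real CARD('d) * ln (2 + B * R / sqrt (real CARD('d))) / (real n + 1)"
  proof -
    \<comment> \<open>The choice \<open>c = d / B^2\<close> produces the argument
      \<open>t = B * R / sqrt d\<close> of \<open>log_bound\<close>.\<close>
    have "R\<^sup>2 / c = (B * R / sqrt d)\<^sup>2"
      using d \<open>B > 0\<close> by (simp add: c_def power_divide power_mult_distrib)
    then have "3/2 + ln (1 + R\<^sup>2 / c) \<le> 5 * ln (2 + B * R / sqrt d)"
      using log_bound[of "B * R / sqrt d"] d \<open>B > 0\<close> \<open>R > 0\<close> by simp
    then have "K \<le> d / (real n + 1) * (5 * ln (2 + B * R / sqrt d))"
      unfolding K_def using d by (intro mult_left_mono) auto
    then show ?thesis
      by (simp add: d_def mult_ac)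
  qed
  ultimately have "(\<integral>z. F z \<partial>Q) - (INF \<theta>\<in>{\<theta> :: real ^ 'd. norm \<theta> \<le> B}. risk M (X 0) (Y 0) (gauss_lin \<theta>))
      \<le> 5 * real CARD('d) * ln (2 + B * R / sqrt (real CARD('d))) / (real n + 1)"
    by linarith
  then show ?thesis
    unfolding loss risk_loss using resample by simp
qed

end
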